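(* For every pair of integers $n\ge 1$, $m\ge 1$, the decision $$\mathcal{S}(n,m):=\begin{cases} 0, & \text{if } n=1 \text{ or } m=1,\\ 1, & \text{if } (n,m)=(4,4),\\ 3, & \text{if } (n,m)=(6,4),\\ 5, & \text{if } (n,m)=(10,4),\\ n_<, & \text{otherwise},\end{cases}$$ is an optimal decision at board state $(n,m)$ of bipartite Guess Who. Here $n_<:=1$ if $n=2$, and $n_<:=\left\lfloor \frac{n}{4}\right\rfloor+\left\lfloor\frac{n+1}{4}\right\rfloor$ if $n\ge 3$.
   Context: Bipartite Guess Who is the following two-player zero-sum game of chance. A board state $(n,m)$ (with integers $n,m\ge 1$) means: the player to move has $n$ remaining suspects, one of which (uniformly at random) is the opponent's mystery person, and the opponent has $m$ remaining suspects. At board state $(n,m)$ the player to move chooses a decision: either the decision $0$ ("guess"), which ends the game and wins for the mover with probability $1/n$ and loses otherwise; or an integer $k$ with $1\le k\le n/2$ (asking whether the mystery person lies in a chosen set of $k$ of the $n$ suspects), after which, with probability $k/n$, it becomes the opponent's turn at board state $(m,k)$, and with probability $(n-k)/n$, at board state $(m,n-k)$. Let $P(n,m)$ denote the probability that the player to move at $(n,m)$ wins when both players play optimally; it is determined (by induction on $n+m$) by $$P(n,m)=\max\Big(\tfrac1n,\ \max_{1\le k\le n/2}\Big(1-\tfrac{k}{n}P(m,k)-\tfrac{n-k}{n}P(m,n-k)\Big)\Big),$$ where the inner maximum is omitted when $n=1$ (so $P(1,m)=1$). A decision at $(n,m)$ is optimal if it attains this maximum (the guess attaining $1/n$, or $k$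 attaining the corresponding value). *)

theory Defs
  imports Complex_Main
begin

text \<open>
  Bipartite Guess Who.  A decision at board state \<open>(n, m)\<close> is encoded as a natural number:
  \<open>0\<close> is the guess, and \<open>k \<ge> 1\<close> is a question about \<open>k\<close> of the \<open>n\<close> suspects.
  Board states have \<open>n, m \<ge> 1\<close>; values at other arguments are irrelevant.
\<close>

definition decisions :: "nat \<Rightarrow> nat set" where
  "decisions n = insert 0 {1..n div 2}"

text \<open>
  The probability that the player to move at \<open>(n, m)\<close> wins under optimal play.  After a question
  the roles are swapped, so the mover wins exactly when the opponent, who is then the player
  to move, loses.  For \<open>n < 2\<close> there are no questions and the inner maximum is omitted.
\<close>

function win_prob :: "nat \<Rightarrow> nat \<Rightarrow> real" where
  "win_prob n m =
     (if n < 2 then 1 / real n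
      else max (1 / real n)
        (MAX k\<in>{1..n div 2}.
           1 - real k / real n * win_prob m k - real (n - k) / real n * win_prob m (n - k)))"
  by pat_completeness auto
termination
  by (relation "measure (\<lambda>(n, m). n + m)") auto

declare win_prob.simps [simp del]

text \<open>The mover's winning probability when taking decision \<open>d\<close> and both players playing
  optimally afterwards.\<close>

definition decision_value :: "nat \<Rightarrow> nat \<Rightarrow> nat \<Rightarrow> real" where
  "decision_value n m d =
     (if d = 0 then 1 / real n
      else 1 - real d / real n * win_prob m d - real (n - d) / real n * win_prob m (n - d))"

lemma win_prob_eq_Max: "win_prob n m = Max (decision_value n m ` decisions n)"
proof (cases "n < 2")
  case True
  then have "decisions n = {0}"
    by (auto simp: decisions_def)
  with True show ?thesis
    by (simp add: win_prob.simps[of n m] decision_value_def)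
next
  case False
  let ?K = "{1..n div 2}"
  have "?K \<noteq> {}"
    using False by simp
  then have "Max (insert (1 / real n) (decision_value n m ` ?K))
      = max (1 / real n) (Max (decision_value n m ` ?K))"
    by (intro Max_insert) auto
  moreover have "decision_value n m ` decisions n
      = insert (1 / real n) (decision_value n m ` ?K)"
    unfolding decisions_def image_insert by (simp add: decision_value_def)
  moreover have "decision_value n m ` ?K =
      (\<lambda>k. 1 - real k / real n * win_prob m k
              - real (n - k) / real n * win_prob m (n - k)) ` ?K"
    by (rule image_cong) (auto simp: decision_value_def)
  ultimately show ?thesis
    using False by (simp only: win_prob.simps[of n m] if_False)
qed

definition optimal_decision :: "nat \<Rightarrow> nat \<Rightarrow> nat \<Rightarrow> bool" where
  "optimal_decision n m d \<longleftrightarrow> d \<in> decisions n \<and> decision_value n m d = win_prob n m"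

definition n_lt :: "nat \<Rightarrow> nat" where
  "n_lt n = (if n = 2 then 1 else n div 4 + (n + 1) div 4)"

definition strategy :: "nat \<Rightarrow> nat \<Rightarrow> nat" where
  "strategy n m =
     (if n = 1 \<or> m = 1 then 0
      else if (n, m) = (4, 4) then 1
      else if (n, m) = (6, 4) then 3
      else if (n, m) = (10, 4) then 5
      else n_lt n)"

end

theory Submission
  imports Defs
begin

text \<open>
  The scaled value \<open>V n m = n m P(n, m)\<close> satisfies
  \<open>V n m = n m - min\<^sub>k (V m k + V m (n - k))\<close>, so the claim says which splits of \<open>n\<close> minimise
  \<open>V m k + V m (n - k)\<close>.  Let \<open>payoff\<close> be the solution of this recursion along the strategy.
  The split into \<open>n_lt n\<close> and \<open>n - n_lt n\<close> is minimal for any function whose increments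
  \<open>d\<close> satisfy \<open>d k \<le> d (k + 2)\<close> and, for even \<open>k\<close>, \<open>d (k + 1) \<le> d k\<close>.  Away from
  small and exceptional states, unfolding the recursion in both arguments expresses the increment
  of \<open>payoff n\<close> at \<open>k\<close> as the sum of those of \<open>payoff (n_lt n)\<close> and \<open>payoff (n - n_lt n)\<close> at a point
  \<open>moved k\<close> that respects the shifts above, so the two inequalities are inherited by induction
  on \<open>n\<close>.  They fail only for \<open>n = 4\<close>, where \<open>payoff 4\<close> is explicit; this is the source of the
  three exceptional states.
\<close>

section \<open>Scaled values along the strategy, and their small cases\<close>

lemma strategy_bounds:
  assumes "2 \<le> n" "2 \<le> m"
  shows "1 \<le> strategy n m" "strategy n m \<le> n div 2"
  using assms by (auto simp: strategy_def n_lt_def)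

text \<open>Scaling by \<open>n * m\<close> clears all denominators, so the values are integers. At
  board states both base cases are the guess, whose scaled value is \<open>m\<close>.\<close>

function payoff :: "nat \<Rightarrow> nat \<Rightarrow> int" where
  "payoff n m =
     (if n < 2 then int m
      else if m < 2 then 1
      else int (n * m) - payoff m (strategy n m) - payoff m (n - strategy n m))"
  by pat_completeness auto
termination
proof (relation "measure (\<lambda>(n, m). n + m)", goal_cases)
  case (2 n m)
  then show ?case using strategy_bounds[of n m] by auto
next
  case (3 n m)
  then show ?case using strategy_bounds[of n m] by auto
qed simp

declare payoff.simps [simp del]

lemma payoff_1_left [simp]: "payoff (Suc 0) m = int m"
  by (simp add: payoff.simps)

lemma payoff_1_right [simp]: "1 \<le> n \<Longrightarrow> payoff n (Suc 0) = 1"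
  by (simp add: payoff.simps)

lemma payoff_rec:
  assumes "2 \<le> n" "2 \<le> m" "(n, m) \<notin> {(4, 4), (6, 4), (10, 4)}"
  shows "payoff n m = int (n * m) - payoff m (n_lt n) - payoff m (n - n_lt n)"
  using assms by (subst payoff.simps) (auto simp: strategy_def)

lemma payoff_2_left: "2 \<le> m \<Longrightarrow> payoff 2 m = 2 * int m - 2"
  by (subst payoff_rec) (auto simp: n_lt_def)

text \<open>Both halves are at least \<open>2 * (n div 4)\<close>, the largest even number not
  exceeding \<open>n / 2\<close>.\<close>

lemma n_lt_ge:
  assumes "2 * j \<le> n" "even j"
  shows "j \<le> n_lt n" "j \<le> n - n_lt n"
proof -
  obtain b where j: "j = 2 * b" using assms(2) by (elim evenE)
  define q where "q = n div 4"
  have "b \<le> q" using assms(1) unfolding j q_def by linarith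
  moreover consider "n = 4 * q" | "n = 4 * q + 1" | "n = 4 * q + 2" | "n = 4 * q + 3"
    unfolding q_def by linarith
  then have "n = 2 \<and> q = 0 \<or> 2 * q \<le> n_lt n \<and> 2 * q \<le> n - n_lt n"
    by cases (auto simp: n_lt_def)
  ultimately show "j \<le> n_lt n" "j \<le> n - n_lt n"
    unfolding j by auto
qed

lemma payoff_2_right: "4 \<le> n \<Longrightarrow> payoff n 2 = 4"
  using n_lt_ge[of 2 n] by (subst payoff_rec) (auto simp: payoff_2_left of_nat_diff)

lemma payoff_3_left: "4 \<le> m \<Longrightarrow> payoff 3 m = 3 * int m - 5"
  by (subst payoff_rec) (auto simp: payoff_2_right n_lt_def)

lemma payoff_4_left: "5 \<le> m \<Longrightarrow> payoff 4 m = 4 * int m - 8"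
  by (subst payoff_rec) (auto simp: payoff_2_right n_lt_def numeral_2_eq_2[symmetric])

lemma payoff_small:
  "payoff 2 2 = 2" "payoff 2 3 = 4" "payoff 3 2 = 3" "payoff 3 3 = 5"
  "payoff 4 2 = 4" "payoff 4 3 = 6" "payoff 4 4 = 9"
  by (simp_all add: payoff.simps strategy_def n_lt_def)

section \<open>Parity convexity and minimal splits\<close>

definition incr :: "(nat \<Rightarrow> int) \<Rightarrow> nat \<Rightarrow> int" where
  "incr f k = f (k + 1) - f k"

text \<open>The threshold \<open>K\<close> is there for \<open>payoff 4\<close>, which is handled
  only from 5 on, where it is linear.\<close>

definition parity_convex :: "nat \<Rightarrow> (nat \<Rightarrow> int) \<Rightarrow> bool" where
  "parity_convex K f \<longleftrightarrow>
     (\<forall>k\<ge>K. incr f k \<le> incr f (k + 2)) \<and> (\<forall>k\<ge>K. even k \<longrightarrow> incr f (k + 1) \<le> incr f k)"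

lemma parity_convexD:
  assumes "parity_convex K f" "K \<le> k"
  shows "incr f k \<le> incr f (k + 2)" "even k \<Longrightarrow> incr f (k + 1) \<le> incr f k"
  using assms by (auto simp: parity_convex_def)

lemma parity_convex_two_step:
  assumes "parity_convex 1 f" "1 \<le> x" "x \<le> y"
  shows "f (x + 2) - f x \<le> f (y + 2) - f y"
  using assms(3)
proof (induction y rule: dec_induct)
  case base
  then show ?case by simp
next
  case (step y)
  then have "incr f y \<le> incr f (y + 2)"
    using parity_convexD(1)[OF assms(1), of y] assms(2) by simp
  then have "f (y + 2) - f y \<le> f (Suc y + 2) - f (Suc y)"
    by (simp add: incr_def)
  with step.IH show ?case by linarith
qed

text \<open>Moving two suspects from the larger part to the smaller never increases the sum. The
  bound \<open>n + 2\<close> lets the final point overshoot \<open>n / 2\<close> by one, which is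
  used for odd \<open>n\<close>.\<close>

lemma split_two_step:
  assumes f: "parity_convex 1 f" and k: "1 \<le> k" and "2 * (k + 2 * i) \<le> n + 2"
  shows "f (k + 2 * i) + f (n - (k + 2 * i)) \<le> f k + f (n - k)"
  using assms(3)
proof (induction i)
  case 0
  then show ?case by simp
next
  case (Suc i)
  let ?k = "k + 2 * i"
  have "f (?k + 2) - f ?k \<le> f (n - ?k - 2 + 2) - f (n - ?k - 2)"
    using Suc.prems k by (intro parity_convex_two_step[OF f]) auto
  moreover have "n - ?k - 2 + 2 = n - ?k"
    using Suc.prems k by auto
  ultimately have "f (k + 2 * Suc i) + f (n - (k + 2 * Suc i)) \<le> f ?k + f (n - ?k)"
    by (simp add: algebra_simps)
  also have "\<dots> \<le> f k + f (n - k)"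
    using Suc.prems by (intro Suc.IH) auto
  finally show ?case .
qed

lemma split_mono:
  assumes "parity_convex 1 f" "1 \<le> k" "k \<le> k'" "even k \<longleftrightarrow> even k'" "2 * k' \<le> n + 2"
  shows "f k' + f (n - k') \<le> f k + f (n - k)"
proof -
  have "even (k' - k)"
    using assms by simp
  then obtain i where "k' = k + 2 * i"
    using assms(3) by (metis evenE le_add_diff_inverse)
  with split_two_step[OF assms(1,2)] assms(5) show ?thesis by blast
qed

text \<open>Within each parity of \<open>k\<close> the most balanced split is best. For odd
  \<open>n\<close> the two winners are complementary, hence the same split; for even
  \<open>n\<close> the second inequality of \<open>parity_convex\<close> favours two even
  parts.\<close>

lemma split_optimal:
  assumes f: "parity_convex 1 f" and k: "1 \<le> k" "k \<le> n div 2"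
  shows "f (n_lt n) + f (n - n_lt n) \<le> f k + f (n - k)"
proof (cases "n = 2")
  case True
  with k have "k = 1" by simp
  with True show ?thesis by (simp add: n_lt_def)
next
  case n2: False
  define j where "j = n div 4"
  consider "n = 4 * j" | "n = 4 * j + 1" | "n = 4 * j + 2" | "n = 4 * j + 3"
    unfolding j_def by linarith
  then show ?thesis
  proof cases
    case 1
    then have j: "n_lt n = 2 * j" "n - 2 * j = 2 * j" "1 \<le> j"
      using k by (auto simp: n_lt_def)
    show ?thesis
    proof (cases "even k")
      case True
      then show ?thesis
        using split_mono[OF f, of k "2 * j" n] k 1 j by auto
    next
      case False
      then have "k \<le> 2 * j - 1"
        using k 1 by (cases "k = 2 * j") auto
      then have "f (2 * j - 1) + f (n - (2 * j - 1)) \<le> f k + f (n - k)"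
        using False k 1 j by (intro split_mono[OF f]) auto
      moreover have "n - (2 * j - 1) = 2 * j + 1"
        using 1 j by auto
      \<comment> \<open>Both are compared with \<open>incr f (2 * j + 1)\<close>.\<close>
      moreover have "incr f (2 * j - 1) \<le> incr f (2 * j)"
        using parity_convexD(1)[OF f, of "2 * j - 1"] parity_convexD(2)[OF f, of "2 * j"] j
        by fastforce
      ultimately show ?thesis
        using j by (simp add: incr_def)
    qed
  next
    case 2
    then have j: "n_lt n = 2 * j" "n - 2 * j = 2 * j + 1" "n - (2 * j + 1) = 2 * j"
      using k by (auto simp: n_lt_def)
    show ?thesis
    proof (cases "even k")
      case True
      then show ?thesis
        using split_mono[OF f, of k "2 * j" n] k 2 j by auto
    next
      case False
      then show ?thesis
        using split_mono[OF f, of k "2 * j + 1" n] k 2 j by auto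
    qed
  next
    case 3
    then have j: "n_lt n = 2 * j" "n - 2 * j = 2 * j + 2" "n - (2 * j + 1) = 2 * j + 1" "1 \<le> j"
      using k n2 by (auto simp: n_lt_def)
    show ?thesis
    proof (cases "even k")
      case True
      then have "k \<le> 2 * j"
        using k 3 by (cases "k = 2 * j + 1") auto
      then show ?thesis
        using True split_mono[OF f, of k "2 * j" n] k 3 j by auto
    next
      case False
      then have "f (2 * j + 1) + f (n - (2 * j + 1)) \<le> f k + f (n - k)"
        using k 3 by (intro split_mono[OF f]) auto
      then show ?thesis
        using parity_convexD(2)[OF f, of "2 * j"] j by (simp add: incr_def)
    qed
  next
    case 4
    then have j: "n_lt n = 2 * j + 1" "n - (2 * j + 1) = 2 * j + 2" "n - (2 * j + 2) = 2 * j + 1"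
      using k by (auto simp: n_lt_def)
    have "k \<le> 2 * j + 1" using k 4 by linarith
    show ?thesis
    proof (cases "even k")
      case True
      then show ?thesis
        using split_mono[OF f, of k "2 * j + 2" n] \<open>k \<le> 2 * j + 1\<close> k 4 j by auto
    next
      case False
      then show ?thesis
        using split_mono[OF f, of k "2 * j + 1" n] k 4 j by auto
    qed
  qed
qed

section \<open>Increments under the unfolded recursion\<close>

text \<open>Passing from \<open>k\<close> to \<open>k + 1\<close> suspects moves exactly one half of the split \<open>n_lt\<close>,
  from \<open>moved k\<close> to \<open>moved k + 1\<close>.\<close>

definition moved :: "nat \<Rightarrow> nat" where
  "moved k = (if k = 2 then 1 else 2 * (k div 4) + k mod 2)"

lemma moved_simps:
  "moved (4 * j) = 2 * j" "moved (4 * j + 1) = 2 * j + 1"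
  "1 \<le> j \<Longrightarrow> moved (4 * j + 2) = 2 * j" "moved (4 * j + 3) = 2 * j + 1"
  unfolding moved_def by presburger+

text \<open>The half that stays fixed cancels. For \<open>a = 4\<close>, the bound 11 keeps both
  \<open>k\<close> and \<open>k + 1\<close> away from the exceptional states.\<close>

lemma payoff_Suc_left:
  assumes "2 \<le> k" "2 \<le> a" "a = 4 \<Longrightarrow> 11 \<le> k"
  shows "payoff (k + 1) a - payoff k a = int a - incr (payoff a) (moved k)"
proof -
  have rec: "payoff (k + 1) a - payoff k a =
      int a - payoff a (n_lt (k + 1)) - payoff a (k + 1 - n_lt (k + 1))
      + payoff a (n_lt k) + payoff a (k - n_lt k)"
    using assms by (subst (1 2) payoff_rec) (auto simp: algebra_simps)
  define j where "j = k div 4"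
  consider "k = 2" | "k = 4 * j" | "k = 4 * j + 1" | "k = 4 * j + 2" "1 \<le> j" | "k = 4 * j + 3"
    unfolding j_def by linarith
  then show ?thesis
  proof cases
    case 1
    then show ?thesis unfolding rec by (simp add: incr_def n_lt_def moved_def numeral_2_eq_2)
  next
    case 2
    then have "n_lt k = 2 * j" "k - 2 * j = 2 * j" "n_lt (k + 1) = 2 * j"
      "k + 1 - 2 * j = 2 * j + 1"
      using assms by (auto simp: n_lt_def)
    moreover have "moved k = 2 * j" unfolding 2 moved_simps ..
    ultimately show ?thesis unfolding rec by (simp add: incr_def)
  next
    case 3
    then have "n_lt k = 2 * j" "k - 2 * j = 2 * j + 1" "n_lt (k + 1) = 2 * j"
      "k + 1 - 2 * j = 2 * j + 2"
      using assms by (auto simp: n_lt_def)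
    moreover have "moved k = 2 * j + 1" unfolding 3 moved_simps ..
    ultimately show ?thesis unfolding rec by (simp add: incr_def)
  next
    case 4
    then have "n_lt k = 2 * j" "k - 2 * j = 2 * j + 2" "n_lt (k + 1) = 2 * j + 1"
      "k + 1 - (2 * j + 1) = 2 * j + 2"
      using assms by (auto simp: n_lt_def)
    moreover have "moved k = 2 * j" unfolding 4(1) moved_simps(3)[OF 4(2)] ..
    ultimately show ?thesis unfolding rec by (simp add: incr_def)
  next
    case 5
    then have "n_lt k = 2 * j + 1" "k - (2 * j + 1) = 2 * j + 2" "n_lt (k + 1) = 2 * j + 2"
      "k + 1 - (2 * j + 2) = 2 * j + 2"
      using assms by (auto simp: n_lt_def)
    moreover have "moved k = 2 * j + 1" unfolding 5 moved_simps ..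
    ultimately show ?thesis unfolding rec by (simp add: incr_def)
  qed
qed

lemma incr_payoff:
  assumes n: "5 \<le> n" and k: "2 \<le> k" and ex: "6 \<le> n \<Longrightarrow> n \<le> 10 \<Longrightarrow> 11 \<le> k"
  shows "incr (payoff n) k =
    incr (payoff (n_lt n)) (moved k) + incr (payoff (n - n_lt n)) (moved k)"
proof -
  have lt: "n_lt n \<le> n" by (auto simp: n_lt_def)
  have ge: "2 \<le> n_lt n" "2 \<le> n - n_lt n"
    using n_lt_ge[of 2 n] n by auto
  have ex': "11 \<le> k" if "n_lt n = 4 \<or> n - n_lt n = 4"
  proof -
    \<comment> \<open>The sizes 6 to 10 are exactly those whose split has a part equal to 4.\<close>
    have "6 \<le> n \<and> n \<le> 10"
      using that n by (auto simp: n_lt_def split: if_splits)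
    with ex show ?thesis by blast
  qed
  have "incr (payoff n) k = int n
      - (payoff (k + 1) (n_lt n) - payoff k (n_lt n))
      - (payoff (k + 1) (n - n_lt n) - payoff k (n - n_lt n))"
    unfolding incr_def using n k ex by (subst (1 2) payoff_rec) (auto simp: algebra_simps)
  then show ?thesis
    using payoff_Suc_left[OF k ge(1)] payoff_Suc_left[OF k ge(2)] ex' lt
    by (simp add: of_nat_diff)
qed

lemma moved_add_2: "3 \<le> k \<Longrightarrow> moved (k + 2) = moved k \<or> moved (k + 2) = moved k + 2"
  unfolding moved_def by (simp, presburger)

lemma moved_even:
  assumes "4 \<le> k" "even k"
  shows "even (moved k) \<and> moved (k + 1) = moved k + 1"
proof -
  define j where "j = k div 4"
  have "k = 4 * j \<or> k = 4 * j + 2"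
    using assms(2) unfolding j_def by presburger
  then show ?thesis
    using assms(1) moved_simps[of j] by (auto simp: numeral_3_eq_3)
qed

text \<open>\<open>moved\<close> either stalls, giving equality, or advances by two. At
  \<open>k = 2\<close> it goes from 1 to 2, hence the bound 3.\<close>

lemma parity_convex_step:
  assumes "parity_convex K f" "3 \<le> k" "K \<le> moved k"
  shows "incr f (moved k) \<le> incr f (moved (k + 2))"
  using moved_add_2[OF assms(2)] parity_convexD(1)[OF assms(1,3)] by auto

lemma parity_convex_step_even:
  assumes "parity_convex K f" "4 \<le> k" "even k" "K \<le> moved k"
  shows "incr f (moved (k + 1)) \<le> incr f (moved k)"
  using assms moved_even[of k] parity_convexD(2)[of K f "moved k"] by auto

section \<open>Parity convexity of \<open>payoff n\<close> for \<open>n\<close> other than 4\<close>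

lemma parity_convex_payoff_2: "parity_convex 1 (payoff 2)"
proof -
  have "incr (payoff 2) k = (if k = 1 then 1 else 2)" if "1 \<le> k" for k
    using that by (auto simp: incr_def payoff_2_left numeral_2_eq_2[symmetric])
  then show ?thesis by (auto simp: parity_convex_def)
qed

lemma parity_convex_payoff_3: "parity_convex 1 (payoff 3)"
proof -
  have "incr (payoff 3) k = (if k \<le> 3 then 2 else 3)" if "1 \<le> k" for k
  proof -
    from that consider "k = 1" | "k = 2" | "k = 3" | "4 \<le> k" by linarith
    then show ?thesis
      by cases (auto simp: incr_def payoff_3_left payoff_small numeral_2_eq_2[symmetric])
  qed
  then show ?thesis by (auto simp: parity_convex_def)
qed

lemma parity_convex_payoff_4: "parity_convex 5 (payoff 4)"
  by (auto simp: parity_convex_def incr_def payoff_4_left)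

lemma parity_convex_payoff_6_to_10:
  assumes n: "6 \<le> n" "n \<le> 10"
    and a: "parity_convex 5 (payoff (n_lt n))" and b: "parity_convex 5 (payoff (n - n_lt n))"
  shows "parity_convex 1 (payoff n)"
proof -
  \<comment> \<open>For small \<open>k\<close> the recursion \<open>incr_payoff\<close> breaks down: it meets the exceptional states.\<close>
  have "\<forall>n\<in>set [6..<11]. \<forall>k\<in>set [1..<11]. incr (payoff n) k \<le> incr (payoff n) (k + 2) \<and>
      (even k \<longrightarrow> incr (payoff n) (k + 1) \<le> incr (payoff n) k)"
    by code_simp
  then have small: "incr (payoff n) k \<le> incr (payoff n) (k + 2) \<and>
      (even k \<longrightarrow> incr (payoff n) (k + 1) \<le> incr (payoff n) k)" if "k \<in> {1..10}" for k
    using n that unfolding set_upt by simp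
  have large: "incr (payoff n) k \<le> incr (payoff n) (k + 2) \<and>
      (even k \<longrightarrow> incr (payoff n) (k + 1) \<le> incr (payoff n) k)" if k: "11 \<le> k" for k
  proof -
    \<comment> \<open>So only the tail from 5 on is needed of the halves, one of which is
      \<open>payoff 4\<close>.\<close>
    have K: "5 \<le> moved k" using k unfolding moved_def by presburger
    have "incr (payoff n) i =
        incr (payoff (n_lt n)) (moved i) + incr (payoff (n - n_lt n)) (moved i)" if "11 \<le> i" for i
      using that n by (intro incr_payoff) auto
    then show ?thesis
      using parity_convex_step[OF a _ K] parity_convex_step[OF b _ K]
        parity_convex_step_even[OF a _ _ K] parity_convex_step_even[OF b _ _ K] k
      by (auto intro!: add_mono)
  qed
  show ?thesis
    unfolding parity_convex_def
  proof (intro conjI allI impI)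
    fix k :: nat
    assume "1 \<le> k"
    then have "k \<in> {1..10} \<or> 11 \<le> k" by auto
    with small[of k] large[of k]
    show "incr (payoff n) k \<le> incr (payoff n) (k + 2)"
      and "even k \<Longrightarrow> incr (payoff n) (k + 1) \<le> incr (payoff n) k"
      by blast+
  qed
qed

lemma incr_payoff_1: "4 \<le> n \<Longrightarrow> incr (payoff n) 1 = 3"
  by (simp add: incr_def payoff_2_right numeral_2_eq_2[symmetric])

lemma incr_payoff_1_ge: "2 \<le> n \<Longrightarrow> 1 \<le> incr (payoff n) 1 \<and> (3 \<le> n \<longrightarrow> 2 \<le> incr (payoff n) 1)"
proof -
  assume "2 \<le> n"
  then consider "n = 2" | "n = 3" | "4 \<le> n" by linarith
  then show ?thesis
    by cases (auto simp: incr_def payoff_small payoff_2_right numeral_2_eq_2[symmetric])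
qed

text \<open>The inequalities pass to sums, except that \<open>moved\<close> is irregular at 2 and
  the recursion starts at \<open>k = 2\<close>; the shifts from 1 and 2 are therefore treated by
  hand.\<close>

lemma parity_convex_payoff_step:
  assumes n: "n = 5 \<or> 11 \<le> n"
    and a: "parity_convex 1 (payoff (n_lt n))" and b: "parity_convex 1 (payoff (n - n_lt n))"
  shows "parity_convex 1 (payoff n)"
proof -
  have eq: "incr (payoff n) i =
      incr (payoff (n_lt n)) (moved i) + incr (payoff (n - n_lt n)) (moved i)" if "2 \<le> i" for i
    using that n by (intro incr_payoff) auto
  have m: "moved 2 = 1" "moved 3 = 1" "moved 4 = 2" by (simp_all add: moved_def)
  have n5: "5 \<le> n" using n by auto
  have ge: "2 \<le> n_lt n" "2 \<le> n - n_lt n" "3 \<le> n - n_lt n"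
    using n_lt_ge[of 2 n] n5 by (auto simp: n_lt_def)
  \<comment> \<open>Since \<open>moved 3 = 1\<close>, this sums the halves' increments at 1: at
    least 1 and, as the second half is at least 3, at least 2.\<close>
  have "3 \<le> incr (payoff n) 3"
    using eq[of 3] m incr_payoff_1_ge[OF ge(1)] incr_payoff_1_ge[OF ge(2)] ge(3) by simp
  then have one: "incr (payoff n) 1 \<le> incr (payoff n) 3"
    using incr_payoff_1[of n] n5 by linarith
  \<comment> \<open>Needed because \<open>moved 2 = 1\<close> and \<open>moved 4 = 2\<close>; the
    comparison passes through \<open>incr f 3\<close>.\<close>
  have "incr f 1 \<le> incr f 2" if "parity_convex 1 f" for f
    using parity_convexD(1)[OF that, of 1] parity_convexD(2)[OF that, of 2]
    by (simp add: numeral_eq_Suc)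
  from this[OF a] this[OF b] have two: "incr (payoff n) 2 \<le> incr (payoff n) 4"
    using eq[of 2] eq[of 4] m by simp
  have K: "1 \<le> moved k" if "2 \<le> k" for k using that unfolding moved_def by presburger
  have "incr (payoff n) k \<le> incr (payoff n) (k + 2)" if "1 \<le> k" for k
  proof -
    consider "k = 1" | "k = 2" | "3 \<le> k" using \<open>1 \<le> k\<close> by linarith
    then show ?thesis
    proof cases
      case 3
      then show ?thesis
        using parity_convex_step[OF a _ K, of k] parity_convex_step[OF b _ K, of k]
        by (simp add: eq)
    qed (use one two in \<open>simp_all add: numeral_eq_Suc\<close>)
  qed
  moreover have "incr (payoff n) (k + 1) \<le> incr (payoff n) k" if "1 \<le> k" "even k" for k
  proof (cases "k = 2")
    case True
    then show ?thesis using eq[of 2] eq[of 3] m by simp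
  next
    case False
    with that have "4 \<le> k" by presburger
    then show ?thesis
      using parity_convex_step_even[OF a _ \<open>even k\<close> K]
        parity_convex_step_even[OF b _ \<open>even k\<close> K]
      by (simp add: eq)
  qed
  ultimately show ?thesis by (simp add: parity_convex_def)
qed

lemma parity_convex_mono: "parity_convex K f \<Longrightarrow> K \<le> K' \<Longrightarrow> parity_convex K' f"
  by (auto simp: parity_convex_def)

lemma parity_convex_payoff: "2 \<le> n \<Longrightarrow> n \<noteq> 4 \<Longrightarrow> parity_convex 1 (payoff n)"
proof (induction n rule: less_induct)
  case (less n)
  show ?case
  proof (cases "5 \<le> n")
    case False
    with less.prems have "n = 2 \<or> n = 3" by linarith
    then show ?thesis using parity_convex_payoff_2 parity_convex_payoff_3 by auto
  next
    case n: True
    have ab: "2 \<le> n_lt n" "n_lt n < n" "2 \<le> n - n_lt n" "n - n_lt n < n"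
      using n_lt_ge[of 2 n] n by auto
    \<comment> \<open>The threshold 5 also covers \<open>i = 4\<close>, which the induction
      hypothesis excludes.\<close>
    have IH: "parity_convex 5 (payoff i)" if "2 \<le> i" "i < n" for i
      using that less.IH[of i] parity_convex_payoff_4 parity_convex_mono[of 1 _ 5]
      by (cases "i = 4") auto
    show ?thesis
    proof (cases "6 \<le> n \<and> n \<le> 10")
      case True
      with IH ab show ?thesis by (intro parity_convex_payoff_6_to_10) auto
    next
      case False
      with n have n': "n = 5 \<or> 11 \<le> n" by auto
      then have "n_lt n \<noteq> 4" "n - n_lt n \<noteq> 4" by (auto simp: n_lt_def)
      with ab show ?thesis
        by (intro parity_convex_payoff_step[OF n'] less.IH)
    qed
  qed
qed

section \<open>The strategy against questions and the guess, in scaled form\<close>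

lemma payoff_split_optimal_4:
  assumes "2 \<le> n" "1 \<le> k" "k \<le> n div 2"
  shows "payoff 4 (strategy n 4) + payoff 4 (n - strategy n 4) \<le> payoff 4 k + payoff 4 (n - k)"
proof (cases "11 \<le> n")
  case True
  \<comment> \<open>Equality holds from 5 on, and for \<open>n\<close> at least 11 both halves are
    that large, so the strategy attains the resulting lower bound.\<close>
  have lower: "4 * int i - 8 \<le> payoff 4 i" if "1 \<le> i" for i
  proof -
    from that consider "i = 1" | "i = 2" | "i = 3" | "i = 4" | "5 \<le> i" by linarith
    then show ?thesis by cases (auto simp: payoff_small payoff_4_left)
  qed
  have s: "strategy n 4 = n_lt n" using True by (simp add: strategy_def)
  have "5 \<le> n_lt n" "5 \<le> n - n_lt n" using True by (auto simp: n_lt_def)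
  then have "payoff 4 (n_lt n) + payoff 4 (n - n_lt n) = 4 * int n - 16"
    by (simp add: payoff_4_left of_nat_diff)
  also have "\<dots> \<le> payoff 4 k + payoff 4 (n - k)"
  proof -
    have "1 \<le> n - k" "k \<le> n" using assms by auto
    then show ?thesis
      using lower[of k] lower[of "n - k"] assms by (simp add: of_nat_diff)
  qed
  finally show ?thesis unfolding s .
next
  case False
  then have "n \<in> {2,3,4,5,6,7,8,9,10}" "k \<in> {1,2,3,4,5}" using assms by auto
  then show ?thesis
    using assms
    by (auto simp: strategy_def n_lt_def payoff_small payoff_4_left numeral_2_eq_2[symmetric])
qed

lemma payoff_split_optimal:
  assumes "2 \<le> n" "2 \<le> m" "1 \<le> k" "k \<le> n div 2"
  shows "payoff m (strategy n m) + payoff m (n - strategy n m) \<le> payoff m k + payoff m (n - k)"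
proof (cases "m = 4")
  case True
  with assms payoff_split_optimal_4 show ?thesis by blast
next
  case False
  then have "strategy n m = n_lt n" using assms by (simp add: strategy_def)
  with split_optimal[OF parity_convex_payoff[OF assms(2) False] assms(3,4)] show ?thesis by simp
qed

text \<open>This says that the guess does not beat the strategy. The strategy is at least as good as
  asking about one suspect, so it suffices to bound the opponent's value after that
  question.\<close>

lemma payoff_ge: "1 \<le> n \<Longrightarrow> 1 \<le> m \<Longrightarrow> int m \<le> payoff n m"
proof (induction "n + m" arbitrary: n m rule: less_induct)
  case less
  show ?case
  proof (cases "n = 1 \<or> m = 1")
    case True
    with less.prems show ?thesis by auto
  next
    case False
    with less.prems have nm: "2 \<le> n" "2 \<le> m" by auto
    have "payoff n m = int (n * m) - payoff m (strategy n m) - payoff m (n - strategy n m)"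
      using nm by (simp add: payoff.simps[of n m])
    then have ge: "int (n * m) - 1 - payoff m (n - 1) \<le> payoff n m"
      using payoff_split_optimal[OF nm, of 1] nm div_le_mono[OF nm(1), of 2] by simp
    \<comment> \<open>Unfolding the opponent's move returns to \<open>payoff (n - 1)\<close>, where
      the induction hypothesis applies.\<close>
    have "payoff m (n - 1) \<le> int m * int (n - 1) - 1"
    proof (cases "n = 2")
      case True
      then show ?thesis using nm by simp
    next
      case False
      with nm have n: "2 \<le> n - 1" by auto
      let ?s = "strategy m (n - 1)"
      have s: "1 \<le> ?s" "?s \<le> m div 2" using strategy_bounds[OF nm(2) n] by auto
      have "int ?s \<le> payoff (n - 1) ?s" "int (m - ?s) \<le> payoff (n - 1) (m - ?s)"
        by (rule less.hyps; use nm s in linarith)+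
      moreover have "payoff m (n - 1) =
          int (m * (n - 1)) - payoff (n - 1) ?s - payoff (n - 1) (m - ?s)"
        using nm n by (subst payoff.simps) simp
      ultimately show ?thesis using s nm by simp
    qed
    moreover have "int m * int (n - 1) = int (n * m) - int m"
      using nm by (simp add: of_nat_diff algebra_simps)
    ultimately show ?thesis using ge by linarith
  qed
qed

section \<open>Transfer to winning probabilities\<close>

lemma win_prob_eqI:
  assumes "d \<in> decisions n" "\<And>k. k \<in> decisions n \<Longrightarrow> decision_value n m k \<le> decision_value n m d"
  shows "decision_value n m d = win_prob n m"
  unfolding win_prob_eq_Max
  by (rule Max_eqI[symmetric]) (use assms in \<open>auto simp: decisions_def\<close>)

text \<open>Optimality and the value formula are proved together, since comparing decisions requires
  the exact values of the successor states.\<close>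

lemma strategy_optimal:
  "1 \<le> n \<Longrightarrow> 1 \<le> m \<Longrightarrow>
    optimal_decision n m (strategy n m) \<and> win_prob n m = payoff n m / (real n * real m)"
proof (induction "n + m" arbitrary: n m rule: less_induct)
  case less
  have val: "decision_value n m k =
      (int (n * m) - payoff m k - payoff m (n - k)) / (real n * real m)"
    if "1 \<le> k" "k \<le> n div 2" for k
  proof -
    have "real k * win_prob m k = payoff m k / real m"
      "real (n - k) * win_prob m (n - k) = payoff m (n - k) / real m"
      using less that by auto
    moreover have "decision_value n m k =
        1 - (real k * win_prob m k) / real n - (real (n - k) * win_prob m (n - k)) / real n"
      using that unfolding decision_value_def by simp
    ultimately show ?thesis
      using less.prems by (simp only:) (simp add: field_simps)
  qed
  have guess: "decision_value n m 0 = int m / (real n * real m)"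
    using less.prems by (simp add: decision_value_def)
  let ?s = "strategy n m"
  have "?s \<in> decisions n \<and> decision_value n m ?s = payoff n m / (real n * real m) \<and>
    (\<forall>k\<in>decisions n. decision_value n m k \<le> decision_value n m ?s)"
  proof (cases "n = 1 \<or> m = 1")
    case True
    then have s: "?s = 0" by (simp add: strategy_def)
    have "decision_value n m k \<le> decision_value n m 0" if "k \<in> decisions n" for k
    proof (cases "k = 0")
      case False
      with that have k: "1 \<le> k" "k \<le> n div 2" by (auto simp: decisions_def)
      \<comment> \<open>The opponent then wins by guessing, so any question is worth 0.\<close>
      with True have "m = 1" by auto
      with val[OF k] guess k less.prems show ?thesis by (simp add: of_nat_diff)
    qed simp
    with True s guess less.prems show ?thesis by (auto simp: decisions_def)
  next
    case False
    with less.prems have nm: "2 \<le> n" "2 \<le> m" by auto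
    note s = strategy_bounds[OF nm]
    have rec: "payoff n m = int (n * m) - payoff m ?s - payoff m (n - ?s)"
      using nm by (simp add: payoff.simps[of n m])
    have eq: "decision_value n m ?s = payoff n m / (real n * real m)"
      unfolding val[OF s] rec ..
    have "decision_value n m k \<le> decision_value n m ?s" if "k \<in> decisions n" for k
    proof (cases "k = 0")
      case True
      show ?thesis
        unfolding True guess eq using payoff_ge[OF less.prems] by (intro divide_right_mono) auto
    next
      case False
      with that have k: "1 \<le> k" "k \<le> n div 2" by (auto simp: decisions_def)
      show ?thesis
        unfolding val[OF k] eq rec using payoff_split_optimal[OF nm k]
        by (intro divide_right_mono) auto
    qed
    with s eq show ?thesis by (auto simp: decisions_def)
  qed
  then show ?case
    using win_prob_eqI[of ?s n m] unfolding optimal_decision_def by auto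
qed

theorem theorem1p1:
  fixes n m :: nat
  assumes "n \<ge> 1" and "m \<ge> 1"
  shows "optimal_decision n m (strategy n m)"
  using strategy_optimal[OF assms] by blast

end
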